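(* Let $L\ge 2$ and let $\mathcal{N}$ be a positive, monotonically increasing feedforward neural network with weights $\bm{W}_l\in\mathbb{R}^{n_l\times n_{l-1}}$, biases $\bm{b}_l\in\mathbb{R}^{1\times n_l}$ ($l=1,\dots,L$, $n_0=n_L=1$) and activation functions $\sigma_l$ ($l=1,\dots,L-1$); that is, all entries of $\bm{W}_l$ and $\bm{b}_l$ are $\ge 0$, $\sigma_l:\mathbb{R}_{\ge 0}\to\mathbb{R}_{\ge 0}$, and $\sigma_l':\mathbb{R}_{\ge 0}\to\mathbb{R}_{\ge 0}$. Suppose that each $\sigma_l:\mathbb{R}_{\ge 0}\to\mathbb{R}_{\ge 0}$, $l=1,\dots,L-1$, is convex, in the sense that it is twice differentiable with $\sigma_l''(t)\ge 0$ for all $t\ge 0$. Then $\mathcal{N}$ is convex with respect to its input on $\mathbb{R}_{\ge 0}$, i.e. $\mathcal{N}$ is twice differentiable and $\mathcal{N}''(x_0)\ge 0$ for all $x_0\ge 0$.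
   Context: Vectors are row vectors. The network maps a scalar input $x_0\in\mathbb{R}_{\ge 0}=[0,\infty)$ to $\mathcal{N}(x_0)=x_L$, where $\bm{x}_1=\sigma_1(x_0\bm{W}_1^{T}+\bm{b}_1)\in\mathbb{R}^{n_1}$, $\bm{x}_l=\sigma_l(\bm{x}_{l-1}\bm{W}_l^{T}+\bm{b}_l)\in\mathbb{R}^{n_l}$ for $2\le l\le L-1$, and $x_L=\bm{x}_{L-1}\bm{W}_L^{T}+\bm{b}_L\in\mathbb{R}$ (no activation in the last layer), with $n_0=n_L=1$ and the scalar activation functions $\sigma_l$ applied to each component separately. Derivatives at $0$ are one-sided. Convention: a function $f$ on an interval is called convex if $f''(x)\ge 0$ for all $x$ in the interval (in particular it is twice differentiable there). *)

theory Defs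
  imports Complex_Main "Jordan_Normal_Form.Matrix"
begin

text \<open>Layer \<open>l\<close> (for \<open>1 \<le> l \<le> L\<close>) has weight matrix \<open>W l\<close>, bias \<open>b l\<close> and activation \<open>\<sigma> l\<close>;
  \<open>n l\<close> is its width, and \<open>n 0\<close> is the input width. Values at other indices are irrelevant.
  Row vectors, including the biases, are matrices with one row.\<close>

definition scalar_network ::
  "nat \<Rightarrow> (nat \<Rightarrow> nat) \<Rightarrow> (nat \<Rightarrow> real mat) \<Rightarrow> (nat \<Rightarrow> real mat) \<Rightarrow> bool"
where
  "scalar_network L n W b \<longleftrightarrow>
     n 0 = 1 \<and> n L = 1 \<and>
     (\<forall>l\<in>{1..L}. W l \<in> carrier_mat (n l) (n (l - 1)) \<and> b l \<in> carrier_mat 1 (n l))"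

definition affine_layer :: "real mat \<Rightarrow> real mat \<Rightarrow> real mat \<Rightarrow> real mat" where
  "affine_layer A c x = x * transpose_mat A + c"

fun hidden_layer ::
  "(nat \<Rightarrow> real mat) \<Rightarrow> (nat \<Rightarrow> real mat) \<Rightarrow> (nat \<Rightarrow> real \<Rightarrow> real) \<Rightarrow> real \<Rightarrow> nat \<Rightarrow> real mat"
where
  "hidden_layer W b \<sigma> t 0 = mat 1 1 (\<lambda>_. t)"
| "hidden_layer W b \<sigma> t (Suc l) =
     map_mat (\<sigma> (Suc l)) (affine_layer (W (Suc l)) (b (Suc l)) (hidden_layer W b \<sigma> t l))"

text \<open>The output layer is affine, without activation; its \<open>1 \<times> 1\<close> value is read as a scalar.\<close>

definition network ::
  "nat \<Rightarrow> (nat \<Rightarrow> real mat) \<Rightarrow> (nat \<Rightarrow> real mat) \<Rightarrow> (nat \<Rightarrow> real \<Rightarrow> real) \<Rightarrow> real \<Rightarrow> real"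
where
  "network L W b \<sigma> t = affine_layer (W L) (b L) (hidden_layer W b \<sigma> t (L - 1)) $$ (0, 0)"

text \<open>Functions on the half-line are total functions on the reals whose values at negative
  arguments are irrelevant: derivatives are taken within \<open>{0..}\<close>, hence one-sided at \<open>0\<close>.\<close>

definition positive_monotone_network ::
  "nat \<Rightarrow> (nat \<Rightarrow> real mat) \<Rightarrow> (nat \<Rightarrow> real mat) \<Rightarrow> (nat \<Rightarrow> real \<Rightarrow> real) \<Rightarrow> bool"
where
  "positive_monotone_network L W b \<sigma> \<longleftrightarrow>
     (\<forall>l\<in>{1..L}. (\<forall>a\<in>elements_mat (W l). 0 \<le> a) \<and> (\<forall>a\<in>elements_mat (b l). 0 \<le> a)) \<and>
     (\<forall>l\<in>{1..L - 1}. \<forall>t\<ge>0. 0 \<le> \<sigma> l t \<and>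
        (\<exists>D\<ge>0. (\<sigma> l has_real_derivative D) (at t within {0..})))"

text \<open>Unlike \<open>convex_on\<close>, this notion of convexity includes twice differentiability. On a
  nondegenerate interval \<open>S\<close> the values of \<open>f'\<close> on \<open>S\<close> and the numbers \<open>D\<close> are uniquely determined.\<close>

definition twice_diff_convex_on :: "real set \<Rightarrow> (real \<Rightarrow> real) \<Rightarrow> bool" where
  "twice_diff_convex_on S f \<longleftrightarrow>
     (\<exists>f'. (\<forall>x\<in>S. (f has_real_derivative f' x) (at x within S)) \<and>
           (\<forall>x\<in>S. \<exists>D\<ge>0. (f' has_real_derivative D) (at x within S)))"

end

theory Submission
  imports Defs
begin

text \<open>
  Nonnegative, nondecreasing, convex functions on the half-line contain the nonnegative constants
  and the identity and are closed under addition and nonnegative scaling. They are also closed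
  under composition, since \<open>(g \<circ> f)'' = (g'' \<circ> f) f'\<^sup>2 + (g' \<circ> f) f''\<close>;
  here \<open>g' \<ge> 0\<close> is essential, so all three properties are propagated together, entry by
  entry, through the layers.
\<close>

definition nonneg_mono_convex :: "(real \<Rightarrow> real) \<Rightarrow> bool" where
  "nonneg_mono_convex f \<longleftrightarrow>
     (\<exists>f' f''. \<forall>x\<ge>0. 0 \<le> f x \<and> 0 \<le> f' x \<and> 0 \<le> f'' x \<and>
        (f has_real_derivative f' x) (at x within {0..}) \<and>
        (f' has_real_derivative f'' x) (at x within {0..}))"

lemma nonneg_mono_convexI:
  assumes "\<And>x. 0 \<le> x \<Longrightarrow> 0 \<le> f x" "\<And>x. 0 \<le> x \<Longrightarrow> 0 \<le> f' x" "\<And>x. 0 \<le> x \<Longrightarrow> 0 \<le> f'' x"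
    and "\<And>x. 0 \<le> x \<Longrightarrow> (f has_real_derivative f' x) (at x within {0..})"
    and "\<And>x. 0 \<le> x \<Longrightarrow> (f' has_real_derivative f'' x) (at x within {0..})"
  shows "nonneg_mono_convex f"
  unfolding nonneg_mono_convex_def
  by (rule exI[of _ f'], rule exI[of _ f'']) (simp add: assms)

lemma nonneg_mono_convexE:
  assumes "nonneg_mono_convex f"
  obtains f' f'' where
    "\<And>x. 0 \<le> x \<Longrightarrow> 0 \<le> f x" "\<And>x. 0 \<le> x \<Longrightarrow> 0 \<le> f' x" "\<And>x. 0 \<le> x \<Longrightarrow> 0 \<le> f'' x"
    "\<And>x. 0 \<le> x \<Longrightarrow> (f has_real_derivative f' x) (at x within {0..})"
    "\<And>x. 0 \<le> x \<Longrightarrow> (f' has_real_derivative f'' x) (at x within {0..})"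
  using assms unfolding nonneg_mono_convex_def by blast

lemma nonneg_mono_convex_imp_twice_diff_convex_on:
  assumes "nonneg_mono_convex f"
  shows "twice_diff_convex_on {0..} f"
  using assms
proof (rule nonneg_mono_convexE)
  fix f' f''
  assume "\<And>x. 0 \<le> x \<Longrightarrow> 0 \<le> f'' x"
    "\<And>x. 0 \<le> x \<Longrightarrow> (f has_real_derivative f' x) (at x within {0..})"
    "\<And>x. 0 \<le> x \<Longrightarrow> (f' has_real_derivative f'' x) (at x within {0..})"
  then show ?thesis
    unfolding twice_diff_convex_on_def atLeast_iff by blast
qed

text \<open>Brings the hypotheses on an activation into the form that the closure lemmas use.
  Convexity supplies some first derivative and monotonicity supplies a nonnegative one at each
  point; uniqueness of derivatives makes them agree.\<close>

lemma twice_diff_convex_on_imp_nonneg_mono_convex: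
  assumes "twice_diff_convex_on {0..} f"
    and nonneg: "\<And>x. 0 \<le> x \<Longrightarrow> 0 \<le> f x"
    and mono: "\<And>x. 0 \<le> x \<Longrightarrow> \<exists>D\<ge>0. (f has_real_derivative D) (at x within {0..})"
  shows "nonneg_mono_convex f"
proof -
  obtain f' where f': "\<And>x. 0 \<le> x \<Longrightarrow> (f has_real_derivative f' x) (at x within {0..})"
    and "\<forall>x\<in>{0..}. \<exists>D\<ge>0. (f' has_real_derivative D) (at x within {0..})"
    using assms(1) unfolding twice_diff_convex_on_def atLeast_iff by blast
  then obtain f'' where f'':
    "\<forall>x\<in>{0..}. 0 \<le> f'' x \<and> (f' has_real_derivative f'' x) (at x within {0..})"
    by (auto dest: bchoice)
  have "0 \<le> f' x" if x: "0 \<le> x" for x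
  proof -
    obtain D where D: "0 \<le> D" "(f has_real_derivative D) (at x within {0..})"
      using mono[OF x] by blast
    \<comment> \<open>Both derivatives are restricted to the right of \<open>x\<close>, where the
      filter is nontrivial and limits are unique. This treats the endpoint \<open>0\<close> and
      interior points alike.\<close>
    have "{x<..} \<subseteq> {0..}" using x by auto
    then have "(f has_real_derivative D) (at_right x)" "(f has_real_derivative f' x) (at_right x)"
      using D(2) f'[OF x] by (blast intro: has_field_derivative_subset)+
    then have "D = f' x"
      unfolding has_field_derivative_iff by (rule tendsto_unique[OF trivial_limit_at_right_real])
    with D(1) show ?thesis by simp
  qed
  with nonneg f' f'' show ?thesis
    by (intro nonneg_mono_convexI[of f f' f'']) simp_all
qed

lemma nonneg_mono_convex_const: "0 \<le> c \<Longrightarrow> nonneg_mono_convex (\<lambda>_. c)"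
  by (rule nonneg_mono_convexI[of _ "\<lambda>_. 0" "\<lambda>_. 0"]) simp_all

lemma nonneg_mono_convex_ident: "nonneg_mono_convex (\<lambda>x. x)"
  by (rule nonneg_mono_convexI[of _ "\<lambda>_. 1" "\<lambda>_. 0"]) simp_all

lemma nonneg_mono_convex_add:
  assumes "nonneg_mono_convex f" "nonneg_mono_convex g"
  shows "nonneg_mono_convex (\<lambda>x. f x + g x)"
proof -
  obtain f' f'' where f: "\<And>x. 0 \<le> x \<Longrightarrow> 0 \<le> f x" "\<And>x. 0 \<le> x \<Longrightarrow> 0 \<le> f' x" "\<And>x. 0 \<le> x \<Longrightarrow> 0 \<le> f'' x"
    "\<And>x. 0 \<le> x \<Longrightarrow> (f has_real_derivative f' x) (at x within {0..})"
    "\<And>x. 0 \<le> x \<Longrightarrow> (f' has_real_derivative f'' x) (at x within {0..})"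
    using assms(1) by (rule nonneg_mono_convexE) blast
  obtain g' g'' where g: "\<And>x. 0 \<le> x \<Longrightarrow> 0 \<le> g x" "\<And>x. 0 \<le> x \<Longrightarrow> 0 \<le> g' x" "\<And>x. 0 \<le> x \<Longrightarrow> 0 \<le> g'' x"
    "\<And>x. 0 \<le> x \<Longrightarrow> (g has_real_derivative g' x) (at x within {0..})"
    "\<And>x. 0 \<le> x \<Longrightarrow> (g' has_real_derivative g'' x) (at x within {0..})"
    using assms(2) by (rule nonneg_mono_convexE) blast
  show ?thesis
    by (rule nonneg_mono_convexI[of _ "\<lambda>x. f' x + g' x" "\<lambda>x. f'' x + g'' x"])
      (simp_all add: f g DERIV_add)
qed

text \<open>The constant stands on the right because the weights do so in a product of a row vector
  with a transposed weight matrix.\<close>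

lemma nonneg_mono_convex_mult_right:
  assumes "nonneg_mono_convex f" "0 \<le> c"
  shows "nonneg_mono_convex (\<lambda>x. f x * c)"
proof -
  obtain f' f'' where f: "\<And>x. 0 \<le> x \<Longrightarrow> 0 \<le> f x" "\<And>x. 0 \<le> x \<Longrightarrow> 0 \<le> f' x" "\<And>x. 0 \<le> x \<Longrightarrow> 0 \<le> f'' x"
    "\<And>x. 0 \<le> x \<Longrightarrow> (f has_real_derivative f' x) (at x within {0..})"
    "\<And>x. 0 \<le> x \<Longrightarrow> (f' has_real_derivative f'' x) (at x within {0..})"
    using assms(1) by (rule nonneg_mono_convexE) blast
  show ?thesis
    by (rule nonneg_mono_convexI[of _ "\<lambda>x. f' x * c" "\<lambda>x. f'' x * c"])
      (simp_all add: f assms(2) DERIV_cmult_right)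
qed

lemma nonneg_mono_convex_sum:
  "(\<And>i. i \<in> I \<Longrightarrow> nonneg_mono_convex (f i)) \<Longrightarrow> nonneg_mono_convex (\<lambda>x. \<Sum>i\<in>I. f i x)"
  \<comment> \<open>A sum over an infinite \<open>I\<close> is 0 by convention, so the constant
    function settles that case as well as the empty one.\<close>
  by (induction I rule: infinite_finite_induct)
    (auto intro: nonneg_mono_convex_const nonneg_mono_convex_add)

lemma nonneg_mono_convex_compose:
  assumes "nonneg_mono_convex g" "nonneg_mono_convex f"
  shows "nonneg_mono_convex (\<lambda>x. g (f x))"
proof -
  obtain f' f'' where f: "\<And>x. 0 \<le> x \<Longrightarrow> 0 \<le> f x" "\<And>x. 0 \<le> x \<Longrightarrow> 0 \<le> f' x" "\<And>x. 0 \<le> x \<Longrightarrow> 0 \<le> f'' x"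
    "\<And>x. 0 \<le> x \<Longrightarrow> (f has_real_derivative f' x) (at x within {0..})"
    "\<And>x. 0 \<le> x \<Longrightarrow> (f' has_real_derivative f'' x) (at x within {0..})"
    using assms(2) by (rule nonneg_mono_convexE) blast
  obtain g' g'' where g: "\<And>x. 0 \<le> x \<Longrightarrow> 0 \<le> g x" "\<And>x. 0 \<le> x \<Longrightarrow> 0 \<le> g' x" "\<And>x. 0 \<le> x \<Longrightarrow> 0 \<le> g'' x"
    "\<And>x. 0 \<le> x \<Longrightarrow> (g has_real_derivative g' x) (at x within {0..})"
    "\<And>x. 0 \<le> x \<Longrightarrow> (g' has_real_derivative g'' x) (at x within {0..})"
    using assms(1) by (rule nonneg_mono_convexE) blast
  \<comment> \<open>Nonnegativity of \<open>f\<close> enters here: \<open>g\<close> has derivatives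
    only within \<open>{0..}\<close>, and at a zero of \<open>f\<close> only a one-sided one, so the
    chain rule needs \<open>f\<close> to stay in the half-line.\<close>
  have image: "f ` {0..} \<subseteq> {0..}"
    using f(1) by auto
  \<comment> \<open>Stated for arbitrary \<open>h\<close>, since it is applied to \<open>g\<close>
    for the first derivative and to \<open>g'\<close> for the second.\<close>
  have chain: "((\<lambda>x. h (f x)) has_real_derivative D * f' x) (at x within {0..})"
    if "0 \<le> x" "(h has_real_derivative D) (at (f x) within {0..})" for h D x
    using DERIV_image_chain[OF has_field_derivative_subset[OF that(2) image] f(4)[OF that(1)]]
    by (simp add: o_def)
  show ?thesis
  proof (rule nonneg_mono_convexI)
    fix x :: real assume x: "0 \<le> x"
    show "0 \<le> g (f x)" "0 \<le> g' (f x) * f' x" "0 \<le> g'' (f x) * f' x * f' x + f'' x * g' (f x)"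
      using f(1-3)[OF x] g(1-3) by simp_all
    show "((\<lambda>x. g (f x)) has_real_derivative g' (f x) * f' x) (at x within {0..})"
      by (rule chain[OF x g(4)[OF f(1)[OF x]]])
    show "((\<lambda>x. g' (f x) * f' x) has_real_derivative g'' (f x) * f' x * f' x + f'' x * g' (f x))
        (at x within {0..})"
      by (rule DERIV_mult[OF chain[OF x g(5)[OF f(1)[OF x]]] f(5)[OF x]])
  qed
qed

lemma affine_layer_carrier:
  assumes "A \<in> carrier_mat m k" "c \<in> carrier_mat 1 m" "x \<in> carrier_mat 1 k"
  shows "affine_layer A c x \<in> carrier_mat 1 m"
  using assms by (simp add: affine_layer_def)

lemma affine_layer_index:
  assumes "A \<in> carrier_mat m k" "c \<in> carrier_mat 1 m" "x \<in> carrier_mat 1 k" "j < m"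
  shows "affine_layer A c x $$ (0, j) = (\<Sum>i<k. x $$ (0, i) * A $$ (j, i)) + c $$ (0, j)"
  using assms by (simp add: affine_layer_def scalar_prod_def atLeast0LessThan)

text \<open>Each output entry is a combination of the input entries with nonnegative coefficients,
  plus a nonnegative constant. The signs of weights and biases matter here.\<close>

lemma nonneg_mono_convex_affine_layer:
  assumes A: "A \<in> carrier_mat m k" "\<forall>a\<in>elements_mat A. 0 \<le> a"
    and c: "c \<in> carrier_mat 1 m" "\<forall>a\<in>elements_mat c. 0 \<le> a"
    and X: "\<And>t. X t \<in> carrier_mat 1 k"
      "\<And>i. i < k \<Longrightarrow> nonneg_mono_convex (\<lambda>t. X t $$ (0, i))"
    and j: "j < m"
  shows "nonneg_mono_convex (\<lambda>t. affine_layer A c (X t) $$ (0, j))"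
proof -
  have "0 \<le> A $$ (j, i)" if "i < k" for i
    using A j that by (auto intro: elements_matI)
  moreover have "0 \<le> c $$ (0, j)"
    using c j by (auto intro: elements_matI)
  ultimately show ?thesis
    unfolding affine_layer_index[OF A(1) c(1) X(1) j]
    by (intro nonneg_mono_convex_add nonneg_mono_convex_sum nonneg_mono_convex_mult_right
        nonneg_mono_convex_const X(2)) auto
qed

lemma hidden_layer_carrier:
  assumes "scalar_network L n W b" "l \<le> L"
  shows "hidden_layer W b \<sigma> t l \<in> carrier_mat 1 (n l)"
  using assms(2)
proof (induction l)
  case 0
  then show ?case using assms(1) by (simp add: scalar_network_def)
next
  case (Suc l)
  then have "W (Suc l) \<in> carrier_mat (n (Suc l)) (n l)" "b (Suc l) \<in> carrier_mat 1 (n (Suc l))"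
    using assms(1) by (force simp: scalar_network_def)+
  then show ?case
    using affine_layer_carrier Suc by (simp del: One_nat_def)
qed

text \<open>Stops before the activation, so that it serves the hidden layers, where composition with
  \<open>\<sigma> (Suc l)\<close> follows, and also the output layer, where nothing follows.\<close>

lemma nonneg_mono_convex_layer:
  assumes net: "scalar_network L n W b" and pos: "positive_monotone_network L W b \<sigma>"
    and l: "l < L" and j: "j < n (Suc l)"
    and hidden: "\<And>i. i < n l \<Longrightarrow> nonneg_mono_convex (\<lambda>t. hidden_layer W b \<sigma> t l $$ (0, i))"
  shows "nonneg_mono_convex
    (\<lambda>t. affine_layer (W (Suc l)) (b (Suc l)) (hidden_layer W b \<sigma> t l) $$ (0, j))"
proof (rule nonneg_mono_convex_affine_layer[where k = "n l"])
  have l': "Suc l \<in> {1..L}" using l by simp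
  show "W (Suc l) \<in> carrier_mat (n (Suc l)) (n l)" "b (Suc l) \<in> carrier_mat 1 (n (Suc l))"
    using net l' by (force simp: scalar_network_def)+
  show "\<forall>a\<in>elements_mat (W (Suc l)). 0 \<le> a" "\<forall>a\<in>elements_mat (b (Suc l)). 0 \<le> a"
    using pos l' unfolding positive_monotone_network_def by blast+
qed (use l j hidden hidden_layer_carrier[OF net] in auto)

lemma nonneg_mono_convex_hidden_layer:
  assumes net: "scalar_network L n W b" and pos: "positive_monotone_network L W b \<sigma>"
    and conv: "\<And>l. l \<in> {1..L - 1} \<Longrightarrow> twice_diff_convex_on {0..} (\<sigma> l)"
    and "l < L" "j < n l"
  shows "nonneg_mono_convex (\<lambda>t. hidden_layer W b \<sigma> t l $$ (0, j))"
  using assms(4,5)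
\<comment> \<open>The entry \<open>j\<close> varies because one entry of a layer depends on all
  entries of the layer before. At layer 0 the only entry is the input itself, hence the identity
  function.\<close>
proof (induction l arbitrary: j)
  case 0
  then show ?case
    using net by (simp add: scalar_network_def nonneg_mono_convex_ident)
next
  case (Suc l)
  have l: "Suc l \<in> {1..L - 1}" using Suc.prems by auto
  let ?a = "\<lambda>t. affine_layer (W (Suc l)) (b (Suc l)) (hidden_layer W b \<sigma> t l)"
  \<comment> \<open>Applying \<open>\<sigma> (Suc l)\<close> entrywise keeps the dimensions, so
    those of the activated layer carry over. They ensure that \<open>(0, j)\<close> is a valid index
    when the entry is read off below.\<close>
  have dims: "?a t \<in> carrier_mat 1 (n (Suc l))" for t
    using hidden_layer_carrier[OF net, of "Suc l" \<sigma> t] Suc.prems by simp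
  have "nonneg_mono_convex (\<sigma> (Suc l))"
    using pos l unfolding positive_monotone_network_def
    by (intro twice_diff_convex_on_imp_nonneg_mono_convex[OF conv[OF l]]) blast+
  moreover have "nonneg_mono_convex (\<lambda>t. ?a t $$ (0, j))"
    using Suc by (intro nonneg_mono_convex_layer[OF net pos]) auto
  ultimately have "nonneg_mono_convex (\<lambda>t. \<sigma> (Suc l) (?a t $$ (0, j)))"
    by (rule nonneg_mono_convex_compose)
  moreover have "hidden_layer W b \<sigma> t (Suc l) $$ (0, j) = \<sigma> (Suc l) (?a t $$ (0, j))" for t
    using dims[of t] Suc.prems by auto
  ultimately show ?case by presburger
qed

theorem corollary3:
  fixes L :: nat and n :: "nat \<Rightarrow> nat"
    and W b :: "nat \<Rightarrow> real mat" and \<sigma> :: "nat \<Rightarrow> real \<Rightarrow> real"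
  assumes "2 \<le> L"
    and "scalar_network L n W b"
    and "positive_monotone_network L W b \<sigma>"
    and "\<And>l. l \<in> {1..L - 1} \<Longrightarrow> twice_diff_convex_on {0..} (\<sigma> l)"
  shows "twice_diff_convex_on {0..} (network L W b \<sigma>)"
proof -
  \<comment> \<open>With this \<open>l\<close>, the last hidden layer \<open>L - 1\<close> is
    \<open>l\<close>, and the network is the affine part of layer \<open>Suc l\<close> at entry
    \<open>j = 0\<close>, a valid index because the output width is 1.\<close>
  obtain l where L: "L = Suc l" using assms(1) by (cases L) auto
  have "0 < n (Suc l)"
    using assms(2) L by (simp add: scalar_network_def)
  then have "nonneg_mono_convex (network L W b \<sigma>)"
    using nonneg_mono_convex_layer[OF assms(2,3), of l 0]
      nonneg_mono_convex_hidden_layer[OF assms(2-4)]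
    by (simp add: L network_def[abs_def])
  then show ?thesis
    by (rule nonneg_mono_convex_imp_twice_diff_convex_on)
qed

end
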